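(* Let $d\ge1$, let $\alpha,\beta$ be complex numbers with $w=\alpha-\beta\ne0$, let $a_1,\dots,a_{d-1}$ be complex numbers, and let $\{P_n\}_{n\ge0}$ be the polynomials defined by $$\sum_{n\ge0}P_n(x)\frac{t^n}{n!}=\left(\frac{1-\beta t}{1-\alpha t}\right)^{x/w}A(t),\qquad \frac1{A(t)}=\exp\left\{\sum_{i=1}^{d-1}a_it^i\right\},$$ assumed to form a $d$-orthogonal polynomial sequence. Let $\{\varphi_r\}_{r\ge0}$ be the dual sequence of $\{P_n\}$. Then for every $0\le r\le d-1$ and every polynomial $f$, \begin{align*} \langle\varphi_r,f\rangle=\frac1{r!}&\sum_{k,n_1,\dots,n_{d-1}\ge0}\frac{a_1^{n_1}}{n_1!}\cdots\frac{a_{d-1}^{n_{d-1}}}{n_{d-1}!}\left(\frac{-1}{w}\right)^{l+r+k}\frac{(l+r)_k(-\alpha)^k}{k!}\\ &\times\left[\sum_{s=0}^{k}\binom{l+r+k}{s+l+r}(-1)^{s+l+r}f\big(w(s+l+r)\big)+\sum_{s=0}^{l+r-1}\binom{l+r+k}{s}(-1)^sf(ws)\right], \end{align*} where $l=n_1+2n_2+\cdots+(d-1)n_{d-1}$.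
   Context: Generating functions are formal power series in $t$. The dual sequence $\{\varphi_r\}_{r\ge0}$ of a sequence of monic polynomials $\{P_n\}_{n\ge0}$ with $\deg P_n=n$ is the sequence of linear functionals on polynomials determined by $\langle\varphi_r,P_m\rangle=\delta_{r,m}$. The symbol $(y)_k=y(y+1)\cdots(y+k-1)$, $(y)_0=1$, is the rising factorial. Empty sums are $0$. A sequence of monic polynomials $\{P_n\}_{n\ge0}$ with $\deg P_n=n$ is a $d$-orthogonal polynomial sequence if there are linear functionals $u_0,\dots,u_{d-1}$ on polynomials such that, for each $0\le r\le d-1$ and all $m\ge0$: $\langle u_r,x^mP_n\rangle=0$ for $n\ge md+r+1$, and $\langle u_r,x^mP_{md+r}\rangle\ne0$. The sequences $\{P_n\}$ of the claim are called Mittag-Leffler $d$-orthogonal polynomials. *)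

theory Defs
  imports "HOL-Analysis.Analysis" "HOL-Computational_Algebra.Computational_Algebra"
begin

text \<open>The formal power \<open>F\<^sup>c\<close> with complex exponent, via the binomial series
  \<open>(1 + (F - 1))\<^sup>c\<close>. It is meaningful only for series \<open>F\<close> with constant term 1.\<close>

definition fps_cpow :: "complex fps \<Rightarrow> complex \<Rightarrow> complex fps" where
  "fps_cpow F c = fps_binomial c oo (F - 1)"

definition poly_functional :: "(complex poly \<Rightarrow> complex) \<Rightarrow> bool" where
  "poly_functional u \<longleftrightarrow> Vector_Spaces.linear smult (*) u"

definition monic_poly_sequence :: "(nat \<Rightarrow> complex poly) \<Rightarrow> bool" where
  "monic_poly_sequence P \<longleftrightarrow> (\<forall>n. degree (P n) = n \<and> lead_coeff (P n) = 1)"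

definition dual_sequence ::
  "(nat \<Rightarrow> complex poly) \<Rightarrow> (nat \<Rightarrow> complex poly \<Rightarrow> complex) \<Rightarrow> bool" where
  "dual_sequence P \<phi> \<longleftrightarrow>
     (\<forall>r. poly_functional (\<phi> r)) \<and>
     (\<forall>r m. \<phi> r (P m) = (if r = m then 1 else 0))"

definition d_orthogonal_sequence :: "nat \<Rightarrow> (nat \<Rightarrow> complex poly) \<Rightarrow> bool" where
  "d_orthogonal_sequence d P \<longleftrightarrow>
     monic_poly_sequence P \<and>
     (\<exists>u. \<forall>r<d. poly_functional (u r) \<and>
        (\<forall>m. (\<forall>n \<ge> m * d + r + 1. u r (monom 1 m * P n) = 0) \<and>
             u r (monom 1 m * P (m * d + r)) \<noteq> 0))"

end

theory Submission
  imports Defs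
begin

text \<open>
  Put \<open>B = (1 - \<beta>t)/(1 - \<alpha>t)\<close>, \<open>T = t/(1 - \<alpha>t)\<close> and \<open>N = l + r + k\<close>. The bracket in the formula
  is the alternating sum of \<open>binom(N, j) f(wj)\<close> over \<open>j \<le> N\<close>, i.e. up to sign the \<open>N\<close>-th difference of
  \<open>f\<close> at 0 with step \<open>w\<close>. Applied in the variable \<open>x\<close> to the generating function \<open>B\<^sup>x\<^sup>/\<^sup>w A\<close>, this
  alternating sum yields \<open>(1 - B)\<^sup>N A\<close> (\<open>step_difference_generating_function\<close>), and
  \<open>1 - B = -wT\<close> (\<open>fps_moebius_quotient\<close>). The factor \<open>(-1/w)\<^sup>N\<close> cancels the powers of \<open>-w\<close>, leaving
  \<open>T\<^sup>N A\<close>.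

  The remaining sums turn this into \<open>t\<^sup>r\<close>. The sum over \<open>k\<close> is the
  binomial series of \<open>(1 + \<alpha>T)\<^sup>-\<^sup>p = (1 - \<alpha>t)\<^sup>p\<close> with \<open>p = l + r\<close>
  (\<open>negative_binomial_series_nth_truncated\<close>), which turns \<open>T\<^sup>p\<close> into \<open>t\<^sup>p\<close>. The sum over the
  \<open>n\<^sub>i\<close> is the expansion of \<open>exp(\<Sum> a\<^sub>i t\<^sup>i) = 1/A\<close> (\<open>fps_exp_polynomial_nth_truncated\<close>), which cancels
  \<open>A\<close>. What is left is \<open>t\<^sup>r\<close>, whose coefficient of \<open>t\<^sup>m/m!\<close> is \<open>r!\<close> for \<open>m = r\<close> and 0
  otherwise; after division by \<open>r!\<close> the right-hand side of the formula takes the value \<open>\<delta>\<^sub>r\<^sub>m\<close> at \<open>P\<^sub>m\<close>,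
  as \<open>\<phi>\<^sub>r\<close> does; since the \<open>P\<^sub>m\<close> span all polynomials, the two functionals agree.

  No analytic convergence is involved: \<open>T\<^sup>N\<close> begins in degree \<open>N\<close>, so differences of order above
  \<open>deg f\<close> annihilate \<open>f\<close> and only finitely many summands are nonzero. For this reason the series
  identities are stated for coefficients up to a bound \<open>M\<close>, with finite sums truncated at \<open>M\<close>.
\<close>

\<comment> \<open>The symbol \<open>$\<close> always denotes a coefficient of a power series here, never a vector component.\<close>
unbundle no vec_syntax

section \<open>Truncated power series identities\<close>

lemma fps_mult_nth_cong:
  fixes f f' g g' :: "'a::comm_semiring_1 fps"
  assumes "\<And>j. j \<le> M \<Longrightarrow> f $ j = f' $ j" "\<And>j. j \<le> M \<Longrightarrow> g $ j = g' $ j" "m \<le> M"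
  shows "(f * g) $ m = (f' * g') $ m"
  unfolding fps_mult_nth by (intro sum.cong refl arg_cong2[where f = times]) (use assms in auto)

lemma fps_prod_nth_cong:
  fixes f g :: "'i \<Rightarrow> 'a::comm_semiring_1 fps"
  assumes "finite I" "\<And>i j. i \<in> I \<Longrightarrow> j \<le> M \<Longrightarrow> f i $ j = g i $ j" "m \<le> M"
  shows "(\<Prod>i\<in>I. f i) $ m = (\<Prod>i\<in>I. g i) $ m"
  using assms
proof (induction I arbitrary: m rule: finite_induct)
  case (insert i I)
  then show ?case
    by (simp, intro fps_mult_nth_cong[where M = M]) auto
qed simp

lemma fps_compose_nth_truncated:
  fixes a b :: "'a::idom fps"
  assumes "b $ 0 = 0" "j \<le> M"
  shows "(a oo b) $ j = (\<Sum>k\<le>M. fps_const (a $ k) * b ^ k) $ j"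
proof -
  have "(a oo b) $ j = (\<Sum>k\<le>j. a $ k * (b ^ k) $ j)"
    by (simp add: fps_compose_nth atLeast0AtMost)
  also have "\<dots> = (\<Sum>k\<le>M. a $ k * (b ^ k) $ j)"
    by (rule sum.mono_neutral_left)
       (use assms startsby_zero_power_prefix[OF assms(1)] in auto)
  finally show ?thesis
    by (simp add: fps_sum_nth)
qed

lemma fps_deriv_exp_compose:
  fixes f :: "'a::field_char_0 fps"
  assumes "f $ 0 = 0"
  shows "fps_deriv (fps_exp 1 oo f) = (fps_exp 1 oo f) * fps_deriv f"
  using fps_compose_deriv[OF assms, of "fps_exp 1"] by simp

lemma fps_exp_compose_mult_uminus:
  fixes f :: "'a::field_char_0 fps"
  assumes "f $ 0 = 0"
  shows "(fps_exp 1 oo f) * (fps_exp 1 oo - f) = 1"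
proof -
  let ?h = "(fps_exp 1 oo f) * (fps_exp 1 oo - f)"
  have "fps_deriv ?h = 0"
    using assms by (simp add: fps_deriv_exp_compose algebra_simps)
  then have "?h = fps_const (?h $ 0)"
    by (rule fps_deriv_eq_0_iff[THEN iffD1])
  then show ?thesis by simp
qed

text \<open>
  The product \<open>exp(f + g) exp(-f) exp(-g)\<close> has derivative zero, hence is the constant 1.
\<close>
lemma fps_exp_compose_add:
  fixes f g :: "'a::field_char_0 fps"
  assumes "f $ 0 = 0" "g $ 0 = 0"
  shows "fps_exp 1 oo (f + g) = (fps_exp 1 oo f) * (fps_exp 1 oo g)"
proof -
  let ?e = "\<lambda>f. fps_exp (1::'a) oo f"
  let ?h = "?e (f + g) * ?e (- f) * ?e (- g)"
  have "fps_deriv ?h = 0"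
    using assms by (simp add: fps_deriv_exp_compose algebra_simps)
  then have "?h = fps_const (?h $ 0)"
    by (rule fps_deriv_eq_0_iff[THEN iffD1])
  then have h: "?h = 1" by simp
  have "?e (f + g) = ?e (f + g) * (?e f * ?e (- f)) * (?e g * ?e (- g))"
    using assms by (simp add: fps_exp_compose_mult_uminus)
  also have "\<dots> = ?h * (?e f * ?e g)"
    by (simp only: mult_ac)
  finally show ?thesis by (simp add: h)
qed

lemma fps_exp_compose_sum:
  fixes f :: "'i \<Rightarrow> 'a::field_char_0 fps"
  assumes "finite I" "\<And>i. i \<in> I \<Longrightarrow> f i $ 0 = 0"
  shows "fps_exp 1 oo (\<Sum>i\<in>I. f i) = (\<Prod>i\<in>I. fps_exp 1 oo f i)"
  using assms
  by (induction I rule: finite_induct) (simp_all add: fps_exp_compose_add fps_sum_nth)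

text \<open>
  Up to a given degree only finitely many exponent vectors contribute to \<open>exp(\<Sum> a\<^sub>i t\<^sup>i)\<close>;
  expanding each factor \<open>exp(a\<^sub>i t\<^sup>i)\<close> separately produces them.
\<close>
lemma fps_exp_polynomial_nth_truncated:
  fixes a :: "nat \<Rightarrow> 'a::field_char_0"
  assumes "finite I" "0 \<notin> I" "m \<le> M"
  shows "(fps_exp 1 oo (\<Sum>i\<in>I. fps_const (a i) * fps_X ^ i)) $ m =
    (\<Sum>n\<in>I \<rightarrow>\<^sub>E {..M}. fps_const (\<Prod>i\<in>I. a i ^ n i / fact (n i)) * fps_X ^ (\<Sum>i\<in>I. i * n i)) $ m"
proof -
  let ?x = "\<lambda>i. fps_const (a i) * fps_X ^ i"
  have z: "?x i $ 0 = 0" if "i \<in> I" for i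
    using that assms(2) by (cases i) auto
  have "(fps_exp 1 oo (\<Sum>i\<in>I. ?x i)) $ m = (\<Prod>i\<in>I. fps_exp 1 oo ?x i) $ m"
    using z assms(1) by (subst fps_exp_compose_sum) auto
  also have "\<dots> = (\<Prod>i\<in>I. \<Sum>j\<le>M. fps_const (1 / fact j) * ?x i ^ j) $ m"
    by (rule fps_prod_nth_cong[OF assms(1) _ assms(3)])
       (use fps_compose_nth_truncated[OF z, where a = "fps_exp 1"] in simp)
  also have "(\<Prod>i\<in>I. \<Sum>j\<le>M. fps_const (1 / fact j) * ?x i ^ j) =
      (\<Sum>n\<in>I \<rightarrow>\<^sub>E {..M}. \<Prod>i\<in>I. fps_const (1 / fact (n i)) * ?x i ^ n i)"
    using assms(1) by (intro prod_sum_PiE) auto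
  also have "\<dots> = (\<Sum>n\<in>I \<rightarrow>\<^sub>E {..M}.
      fps_const (\<Prod>i\<in>I. a i ^ n i / fact (n i)) * fps_X ^ (\<Sum>i\<in>I. i * n i))"
  proof (intro sum.cong refl)
    fix n
    have factor: "fps_const (1 / fact k) * ?x i ^ k = fps_const (a i ^ k / fact k) * fps_X ^ (i * k)"
      for i k
    proof -
      have "?x i ^ k = fps_const (a i ^ k) * fps_X ^ (i * k)"
        by (simp only: power_mult_distrib fps_const_power power_mult)
      moreover have "fps_const (1 / fact k) * fps_const (a i ^ k) = fps_const (a i ^ k / fact k)"
        by simp
      ultimately show ?thesis by (simp only: mult.assoc[symmetric])
    qed
    have "(\<Prod>i\<in>I. fps_const (1 / fact (n i)) * ?x i ^ n i) =
        (\<Prod>i\<in>I. fps_const (a i ^ n i / fact (n i)) * fps_X ^ (i * n i))"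
      by (intro prod.cong refl factor)
    also have "\<dots> = (\<Prod>i\<in>I. fps_const (a i ^ n i / fact (n i))) * fps_X ^ (\<Sum>i\<in>I. i * n i)"
      by (simp add: prod.distrib power_sum)
    also have "(\<Prod>i\<in>I. fps_const (a i ^ n i / fact (n i))) =
        fps_const (\<Prod>i\<in>I. a i ^ n i / fact (n i))"
      using assms(1) by (induction I rule: finite_induct) (auto simp flip: fps_const_mult)
    finally show "(\<Prod>i\<in>I. fps_const (1 / fact (n i)) * ?x i ^ n i) =
      fps_const (\<Prod>i\<in>I. a i ^ n i / fact (n i)) * fps_X ^ (\<Sum>i\<in>I. i * n i)" .
  qed
  finally show ?thesis .
qed

text \<open>
  With \<open>T = t/(1 - \<alpha>t)\<close> one has \<open>1 + \<alpha>T = 1/(1 - \<alpha>t)\<close>. The coefficients below are those of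
  \<open>(1 + \<alpha>y)\<^sup>-\<^sup>p\<close>, so the series becomes \<open>(1 - \<alpha>t)\<^sup>p\<close> at \<open>y = T\<close>.
\<close>
lemma negative_binomial_series_nth_truncated:
  fixes \<alpha> :: "'a::field_char_0" and p :: nat
  defines "T \<equiv> fps_X * inverse (1 - fps_const \<alpha> * fps_X)"
  assumes "j \<le> M"
  shows "(\<Sum>k\<le>M. fps_const (pochhammer (of_nat p) k * (-\<alpha>) ^ k / fact k) * T ^ k) $ j =
    ((1 - fps_const \<alpha> * fps_X) ^ p) $ j"
proof -
  let ?D = "1 - fps_const \<alpha> * fps_X :: 'a fps"
  let ?y = "fps_const \<alpha> * fps_X :: 'a fps"
  let ?F = "fps_binomial (- of_nat p) oo ?y"
  have inv: "inverse ?D * ?D = 1" by (rule inverse_mult_eq_1) simp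
  have T0: "T $ 0 = 0" by (simp add: T_def)
  have "1 + fps_const \<alpha> * T = inverse ?D * ?D + fps_const \<alpha> * fps_X * inverse ?D"
    unfolding inv by (simp add: T_def mult_ac)
  also have "\<dots> = inverse ?D" by (simp add: algebra_simps)
  finally have aT: "1 + fps_const \<alpha> * T = inverse ?D" .
  have "(fps_const \<alpha> * fps_X) oo T = fps_const \<alpha> * T"
    using T0 by (simp add: fps_compose_mult_distrib)
  then have "?F oo T = fps_binomial (- of_nat p) oo (fps_const \<alpha> * T)"
    using T0 by (subst fps_compose_assoc[symmetric]) auto
  also have "\<dots> = inverse ((1 + fps_const \<alpha> * T) ^ p)"
    using T0 by (simp add: fps_binomial_minus_of_nat fps_inverse_compose fps_compose_add_distrib
        fps_compose_power[symmetric])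
  also have "\<dots> = ?D ^ p"
    unfolding aT by (simp add: fps_inverse_power)
  finally have FT: "?F oo T = ?D ^ p" .
  have coeff: "?F $ k = pochhammer (of_nat p) k * (-\<alpha>) ^ k / fact k" for k
    by (simp add: gbinomial_pochhammer flip: power_mult_distrib)
  show ?thesis
    using fps_compose_nth_truncated[OF T0 assms(2), of ?F] unfolding coeff FT by simp
qed

section \<open>Differences with step \<open>w\<close>\<close>

text \<open>
  Up to the sign \<open>(-1)\<^sup>N\<close>, this is the \<open>N\<close>-th forward difference of \<open>f\<close> at 0 with step \<open>w\<close>.
\<close>
definition step_difference :: "complex \<Rightarrow> nat \<Rightarrow> complex poly \<Rightarrow> complex" where
  "step_difference w N f = (\<Sum>j\<le>N. of_nat (N choose j) * (-1) ^ j * poly f (w * of_nat j))"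

lemma step_difference_sum_smult:
  "step_difference w N (\<Sum>m\<in>I. smult (c m) (Q m)) = (\<Sum>m\<in>I. c m * step_difference w N (Q m))"
  unfolding step_difference_def poly_sum poly_smult sum_distrib_left
  by (subst sum.swap) (simp add: mult_ac)

lemma step_difference_split:
  "(\<Sum>s=0..k. of_nat ((p + k) choose (s + p)) * (-1) ^ (s + p) * poly f (w * of_nat (s + p)))
    + (\<Sum>s<p. of_nat ((p + k) choose s) * (-1) ^ s * poly f (w * of_nat s)) =
   step_difference w (p + k) f"
proof -
  define g where "g j = of_nat ((p + k) choose j) * (-1) ^ j * poly f (w * of_nat j)" for j
  have "(\<Sum>s=0..k. g (s + p)) = sum g {p..p + k}"
    using sum.shift_bounds_cl_nat_ivl[of g 0 p k] by (simp add: add.commute)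
  moreover have "sum g {..<p} + sum g {p..p + k} = sum g {..p + k}"
    by (subst sum.union_disjoint[symmetric]) (auto intro: sum.cong)
  ultimately show ?thesis
    unfolding step_difference_def g_def by (simp add: add.commute)
qed

lemma fps_cpow_of_nat:
  assumes "B $ 0 = 1"
  shows "fps_cpow B (of_nat j) = B ^ j"
proof -
  have "fps_cpow B (of_nat j) = ((1 + fps_X) oo (B - 1)) ^ j"
    unfolding fps_cpow_def fps_binomial_of_nat using assms by (subst fps_compose_power) auto
  then show ?thesis using assms by (simp add: fps_compose_add_distrib)
qed

text \<open>
  On the nodes \<open>wj\<close> the power \<open>B\<^sup>x\<^sup>/\<^sup>w\<close> is the honest power \<open>B\<^sup>j\<close>, so the difference operator
  acts on the generating function through the binomial theorem.
\<close>
lemma step_difference_generating_function: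
  assumes "w \<noteq> 0" "B $ 0 = 1"
    and gf: "\<And>x. Abs_fps (\<lambda>n. poly (P n) x / fact n) = fps_cpow B (x / w) * A"
  shows "step_difference w N (P m) = fact m * ((1 - B) ^ N * A) $ m"
proof -
  have node: "poly (P m) (w * of_nat j) = fact m * (B ^ j * A) $ m" for j
  proof -
    have "poly (P m) (w * of_nat j) / fact m = (fps_cpow B (of_nat j) * A) $ m"
      using arg_cong[OF gf[of "w * of_nat j"], of "\<lambda>h. h $ m"] assms(1) by simp
    then show ?thesis
      using fps_cpow_of_nat[OF assms(2)] by (simp add: field_simps)
  qed
  have "(1 - B) ^ N = (- B + 1) ^ N" by simp
  also have "\<dots> = (\<Sum>j\<le>N. of_nat (N choose j) * (- B) ^ j)"
    by (subst binomial_ring) simp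
  also have "\<dots> = (\<Sum>j\<le>N. fps_const (of_nat (N choose j) * (-1) ^ j) * B ^ j)"
    by (intro sum.cong refl)
       (simp add: power_minus[of B] fps_of_nat[symmetric] fps_const_power[symmetric]
          fps_const_neg[symmetric] flip: fps_const_mult)
  finally have "((1 - B) ^ N * A) $ m =
      (\<Sum>j\<le>N. of_nat (N choose j) * (-1) ^ j * (B ^ j * A) $ m)"
    by (simp add: sum_distrib_right fps_sum_nth mult.assoc)
  then show ?thesis
    by (simp add: step_difference_def node sum_distrib_left mult_ac)
qed

lemma fps_moebius_quotient:
  fixes \<alpha> \<beta> :: "'a::field"
  shows "(1 - fps_const \<beta> * fps_X) / (1 - fps_const \<alpha> * fps_X) =
    1 + fps_const (\<alpha> - \<beta>) * (fps_X * inverse (1 - fps_const \<alpha> * fps_X))"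
proof -
  let ?D = "1 - fps_const \<alpha> * fps_X :: 'a fps"
  have inv: "inverse ?D * ?D = 1" by (rule inverse_mult_eq_1) simp
  have "1 - fps_const \<beta> * fps_X = ?D + fps_const (\<alpha> - \<beta>) * fps_X"
    by (simp add: algebra_simps flip: fps_const_sub)
  then have "(1 - fps_const \<beta> * fps_X) / ?D = (?D + fps_const (\<alpha> - \<beta>) * fps_X) * inverse ?D"
    by (simp add: fps_divide_unit)
  also have "\<dots> = inverse ?D * ?D + fps_const (\<alpha> - \<beta>) * (fps_X * inverse ?D)"
    by (simp only: ring_distribs mult_ac)
  finally show ?thesis unfolding inv .
qed

section \<open>Expansion in a monic polynomial sequence\<close>

lemma monic_poly_sequence_expansion:
  assumes "monic_poly_sequence P" "degree f \<le> M"
  shows "\<exists>c. f = (\<Sum>m\<le>M. smult (c m) (P m))"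
  using assms(2)
proof (induction M arbitrary: f)
  case 0
  have "degree (P 0) = 0" "coeff (P 0) 0 = 1"
    using assms(1) unfolding monic_poly_sequence_def by metis+
  then have "P 0 = 1" by (metis degree_0_id one_pCons)
  moreover obtain b where "f = [:b:]" using 0 by (metis degree_0_id le_zero_eq)
  ultimately show ?case by (auto intro!: exI[of _ "\<lambda>_. b"])
next
  case (Suc M)
  let ?b = "coeff f (Suc M)"
  let ?g = "f - smult ?b (P (Suc M))"
  have P: "degree (P (Suc M)) = Suc M" "coeff (P (Suc M)) (Suc M) = 1"
    using assms(1) unfolding monic_poly_sequence_def by metis+
  have "coeff ?g i = 0" if "i > M" for i
    using that P Suc.prems by (cases "i = Suc M") (auto simp: coeff_eq_0)
  then have "degree ?g \<le> M" by (blast intro: degree_le)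
  then obtain c where c: "?g = (\<Sum>m\<le>M. smult (c m) (P m))" using Suc.IH by blast
  have "f = ?g + smult ?b (P (Suc M))" by simp
  also have "\<dots> = (\<Sum>m\<le>M. smult (c m) (P m)) + smult ?b (P (Suc M))" by (simp only: c)
  also have "(\<Sum>m\<le>M. smult (c m) (P m)) = (\<Sum>m\<le>M. smult ((c(Suc M := ?b)) m) (P m))"
    by (intro sum.cong refl) auto
  also have "\<dots> + smult ?b (P (Suc M)) = (\<Sum>m\<le>Suc M. smult ((c(Suc M := ?b)) m) (P m))"
    by simp
  finally show ?case by blast
qed

lemma poly_functional_sum_smult:
  assumes "poly_functional u"
  shows "u (\<Sum>m\<in>I. smult (c m) (Q m)) = (\<Sum>m\<in>I. c m * u (Q m))"
proof -
  interpret Vector_Spaces.linear smult "(*)" u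
    using assms by (simp add: poly_functional_def)
  show ?thesis by (simp add: sum scale)
qed

section \<open>The dual sequence\<close>

theorem proposition4p2:
  fixes d :: nat and \<alpha> \<beta> w :: complex and a :: "nat \<Rightarrow> complex"
    and A :: "complex fps" and P :: "nat \<Rightarrow> complex poly"
    and \<phi> :: "nat \<Rightarrow> complex poly \<Rightarrow> complex"
    and r :: nat and f :: "complex poly"
  assumes "d \<ge> 1"
    and "w = \<alpha> - \<beta>" and "w \<noteq> 0"
    and "inverse A = fps_exp 1 oo (\<Sum>i=1..d-1. fps_const (a i) * fps_X ^ i)"
    and "\<And>x. Abs_fps (\<lambda>n. poly (P n) x / fact n) =
           fps_cpow ((1 - fps_const \<beta> * fps_X) / (1 - fps_const \<alpha> * fps_X)) (x / w) * A"
    and "d_orthogonal_sequence d P"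
    and "dual_sequence P \<phi>"
    and "r \<le> d - 1"
  shows "\<exists>S. ((\<lambda>(k, n). let l = (\<Sum>i=1..d-1. i * n i) in
              (\<Prod>i=1..d-1. a i ^ n i / fact (n i)) * (-1 / w) ^ (l + r + k)
              * (pochhammer (of_nat (l + r)) k * (-\<alpha>) ^ k / fact k)
              * ((\<Sum>s=0..k. of_nat ((l + r + k) choose (s + l + r)) * (-1) ^ (s + l + r)
                    * poly f (w * of_nat (s + l + r)))
                 + (\<Sum>s<l + r. of_nat ((l + r + k) choose s) * (-1) ^ s
                    * poly f (w * of_nat s))))
            has_sum S) (UNIV \<times> ({1..d-1} \<rightarrow>\<^sub>E (UNIV :: nat set)))
         \<and> \<phi> r f = 1 / fact r * S"
    (is "\<exists>S. (?term has_sum S) ?dom \<and> _")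
proof -
  define I where "I = {1..d-1}"
  define l where "l n = (\<Sum>i\<in>I. i * n i)" for n :: "nat \<Rightarrow> nat"
  define b where "b n = (\<Prod>i\<in>I. a i ^ n i / fact (n i))" for n
  define e where "e p k = pochhammer (of_nat p) k * (-\<alpha>) ^ k / fact k" for p k :: nat
  define D where "D = (1 - fps_const \<alpha> * fps_X :: complex fps)"
  define T where "T = fps_X * inverse D"
  define B where "B = (1 - fps_const \<beta> * fps_X) / D"
  have I: "finite I" "0 \<notin> I" by (auto simp: I_def)
  have inv: "inverse D * D = 1" by (rule inverse_mult_eq_1) (simp add: D_def)
  have B: "B = 1 + fps_const w * T"
    unfolding B_def T_def D_def assms(2) by (rule fps_moebius_quotient)
  have B0: "B $ 0 = 1" and T0: "T $ 0 = 0" by (simp_all add: B T_def)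
  have TD: "T ^ p * D ^ p = fps_X ^ p" for p
    using inv by (simp add: T_def flip: power_mult_distrib) (simp add: mult.assoc)
  have AA: "inverse A * A = 1"
  proof (rule inverse_mult_eq_1)
    have "inverse A $ 0 = 1" by (subst assms(4)) simp
    then show "A $ 0 \<noteq> 0" by auto
  qed

  \<comment> \<open>\<open>F q\<close> is the summand of the claim for the polynomial \<open>q\<close>. For \<open>q = P\<^sub>m\<close> it is \<open>m!\<close> times the
    \<open>m\<close>-th coefficient of \<open>G\<close>, so that the sum can be evaluated as a power series.\<close>
  define F where "F q = (\<lambda>(k, n). b n * (-1 / w) ^ (l n + r + k) * e (l n + r) k
      * step_difference w (l n + r + k) q)" for q
  define G where "G k n = fps_const (b n) * (T ^ (l n + r) * (fps_const (e (l n + r) k) * T ^ k)) * A"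
    for k n
  have term_eq: "?term = F f"
    unfolding F_def step_difference_split[symmetric] l_def b_def e_def I_def Let_def
    by (simp only: add.assoc)
  have diff_P: "step_difference w N (P m) = fact m * (- w) ^ N * (T ^ N * A) $ m" for N m
  proof -
    have "1 - B = fps_const (- w) * T" by (simp add: B flip: fps_const_neg)
    then have "(1 - B) ^ N * A = fps_const ((- w) ^ N) * (T ^ N * A)"
      by (simp only: power_mult_distrib fps_const_power mult.assoc)
    then have "((1 - B) ^ N * A) $ m = (- w) ^ N * (T ^ N * A) $ m"
      by (simp only: fps_mult_left_const_nth)
    moreover have "step_difference w N (P m) = fact m * ((1 - B) ^ N * A) $ m"
      using assms(5)[folded D_def, folded B_def]
      by (rule step_difference_generating_function[OF assms(3) B0])
    ultimately show ?thesis by simp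
  qed
  have F_P: "F (P m) (k, n) = fact m * G k n $ m" for m k n
  proof -
    let ?N = "l n + r + k"
    have "G k n = fps_const (b n * e (l n + r) k) * (T ^ ?N * A)"
      by (simp add: G_def power_add mult_ac flip: fps_const_mult)
    then have G: "G k n $ m = b n * e (l n + r) k * (T ^ ?N * A) $ m"
      by (simp only: fps_mult_left_const_nth)
    have "F (P m) (k, n) =
        fact m * ((- 1 / w) ^ ?N * (- w) ^ ?N) * (b n * e (l n + r) k * (T ^ ?N * A) $ m)"
      by (simp only: F_def diff_P prod.case mult_ac)
    also have "(- 1 / w) ^ ?N * (- w) ^ ?N = 1"
      using assms(3) by (simp flip: power_mult_distrib)
    finally show ?thesis by (simp only: G mult_1_right)
  qed

  obtain c where c: "f = (\<Sum>m\<le>degree f. smult (c m) (P m))"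
    using monic_poly_sequence_expansion[of P f "degree f"] assms(6)
    by (auto simp: d_orthogonal_sequence_def)
  define M where "M = degree f"
  have F_f: "F f x = (\<Sum>m\<le>M. c m * F (P m) x)" for x
    by (subst c) (simp add: F_def M_def split_beta step_difference_sum_smult sum_distrib_left mult_ac)

  \<comment> \<open>A difference of order \<open>N > deg f\<close> kills \<open>f\<close>, as \<open>T\<^sup>N\<close> starts at degree \<open>N\<close>.\<close>
  have diff_0: "step_difference w N f = 0" if "N > M" for N
  proof -
    have "(T ^ N * A) $ m = 0" if "m \<le> M" for m
      using startsby_zero_power_prefix[OF T0, of N] that \<open>N > M\<close>
      by (auto simp: fps_mult_nth intro!: sum.neutral)
    then show ?thesis
      by (subst c) (simp add: step_difference_sum_smult diff_P flip: M_def)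
  qed
  let ?E = "{..M} \<times> (I \<rightarrow>\<^sub>E {..M})"
  have support: "F f (k, n) = 0" if n: "n \<in> I \<rightarrow>\<^sub>E UNIV" "(k, n) \<notin> ?E" for k n
  proof -
    have "l n + r + k > M"
    proof (cases "k \<le> M")
      case True
      then have "n \<notin> I \<rightarrow>\<^sub>E {..M}" using n(2) by simp
      then obtain i where i: "i \<in> I" "n i > M"
        using n(1) unfolding PiE_iff by (auto simp: not_le)
      have "1 * n i \<le> i * n i" using i I(2) by (intro mult_right_mono) (cases i, auto)
      also have "\<dots> \<le> l n" unfolding l_def using i(1) I(1) by (intro member_le_sum) auto
      finally show ?thesis using i(2) by simp
    qed simp
    then show ?thesis by (simp add: F_def diff_0)
  qed

  have sum_G: "(\<Sum>n\<in>I \<rightarrow>\<^sub>E {..M}. \<Sum>k\<le>M. G k n $ m) = (if m = r then 1 else 0)" if "m \<le> M" for m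
  proof -
    have e_series: "(\<Sum>k\<le>M. fps_const (e p k) * T ^ k) $ j = (D ^ p) $ j" if "j \<le> M" for p j
      using negative_binomial_series_nth_truncated[OF that, where \<alpha> = \<alpha> and p = p]
      by (simp only: e_def T_def D_def)
    have "(\<Sum>k\<le>M. G k n $ m) = ((fps_const (b n) * fps_X ^ l n) * (fps_X ^ r * A)) $ m" for n
    proof -
      have "(\<Sum>k\<le>M. G k n $ m) =
          ((fps_const (b n) * T ^ (l n + r) * A) * (\<Sum>k\<le>M. fps_const (e (l n + r) k) * T ^ k)) $ m"
        by (simp add: G_def sum_distrib_left fps_sum_nth[symmetric] mult_ac)
      also have "\<dots> = ((fps_const (b n) * T ^ (l n + r) * A) * D ^ (l n + r)) $ m"
        using that by (intro fps_mult_nth_cong[where M = M] e_series refl)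
      also have "(fps_const (b n) * T ^ (l n + r) * A) * D ^ (l n + r) =
          fps_const (b n) * (T ^ (l n + r) * D ^ (l n + r)) * A"
        by (simp only: mult_ac)
      also have "\<dots> = (fps_const (b n) * fps_X ^ l n) * (fps_X ^ r * A)"
        unfolding TD by (simp only: power_add mult_ac)
      finally show ?thesis .
    qed
    moreover have exp_series:
      "(\<Sum>n\<in>I \<rightarrow>\<^sub>E {..M}. fps_const (b n) * fps_X ^ l n) $ j = inverse A $ j" if "j \<le> M" for j
      using fps_exp_polynomial_nth_truncated[OF I that, of a]
      unfolding assms(4) I_def[symmetric] b_def l_def by (rule sym)
    ultimately have "(\<Sum>n\<in>I \<rightarrow>\<^sub>E {..M}. \<Sum>k\<le>M. G k n $ m) =
        ((\<Sum>n\<in>I \<rightarrow>\<^sub>E {..M}. fps_const (b n) * fps_X ^ l n) * (fps_X ^ r * A)) $ m"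
      by (simp only: sum_distrib_right fps_sum_nth)
    also have "\<dots> = (inverse A * (fps_X ^ r * A)) $ m"
      using that by (intro fps_mult_nth_cong[where M = M] exp_series refl)
    also have "inverse A * (fps_X ^ r * A) = (inverse A * A) * fps_X ^ r"
      by (simp only: mult_ac)
    finally show ?thesis by (simp add: AA)
  qed

  have "sum (F f) ?E = (\<Sum>n\<in>I \<rightarrow>\<^sub>E {..M}. \<Sum>k\<le>M. F f (k, n))"
    by (subst sum.swap) (simp add: sum.cartesian_product)
  also have "\<dots> = (\<Sum>n\<in>I \<rightarrow>\<^sub>E {..M}. \<Sum>m\<le>M. \<Sum>k\<le>M. c m * fact m * G k n $ m)"
    unfolding F_f F_P mult.assoc by (intro sum.cong refl sum.swap)
  also have "\<dots> = (\<Sum>m\<le>M. c m * fact m * (\<Sum>n\<in>I \<rightarrow>\<^sub>E {..M}. \<Sum>k\<le>M. G k n $ m))"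
    unfolding sum_distrib_left by (rule sum.swap)
  also have "\<dots> = (\<Sum>m\<le>M. if m = r then c m * fact m else 0)"
    by (intro sum.cong refl) (simp add: sum_G)
  also have "\<dots> = fact r * (if r \<le> M then c r else 0)"
    by simp
  also have "(if r \<le> M then c r else 0) = \<phi> r f"
  proof -
    have "\<phi> r f = (\<Sum>m\<le>M. c m * (if r = m then 1 else 0))"
      using assms(7) by (subst c) (simp add: dual_sequence_def poly_functional_sum_smult M_def)
    then show ?thesis by (simp add: if_distrib[of "times _"] cong: if_cong)
  qed
  finally have S: "sum (F f) ?E = fact r * \<phi> r f" .

  have "(F f has_sum fact r * \<phi> r f) ?E"
    using I(1) S by (intro has_sum_finiteI) (auto intro: finite_PiE)
  then have "(F f has_sum fact r * \<phi> r f) (UNIV \<times> (I \<rightarrow>\<^sub>E UNIV))"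
    by (subst has_sum_cong_neutral[where T = ?E and g = "F f"]) (use support in auto)
  then show ?thesis
    unfolding term_eq by (intro exI[of _ "fact r * \<phi> r f"]) (simp add: I_def)
qed

end
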